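(* Let $\lambda>\lambda_c$, let $\varrho\in(0,1)$, and let $r$ be the radial cavity solution (the minimizer of $I_\varrho$ over $A^\lambda_\varrho$). Assume that $r$ is smooth on $[\varrho,1]$ and that there are constants $r_c>0$, $C_0>0$, $0<m<M$, $Q$ with $r(R)\ge r_c$, $0<r''(R)\le C_0$, $mR\le r'(R)\le MR$ and $|r^{(3)}(R)|\le Q$ for all $R\in[\varrho,1]$. Let $u(x)=\frac{r(|x|)}{|x|}x$, and let $\Pi u$ be the quadratic iso-parametric finite element interpolation of $u$ on a mesh consisting only of elements of types A and B, arranged in one or several layers, each layer being an annulus $\Omega_{(\epsilon,\tau)}$ with $\epsilon\ge\varrho$, $\tau>0$, $\epsilon+\tau\le1$, divided into $2N$ elements ($N$ of type A and $N$ of type B); $\epsilon,\tau,N$ may differ from layer to layer. For a layer put $\kappa=\epsilon/\tau$, $\kappa_0=\frac{r(\epsilon)}{r(\epsilon+\tau)}$, $\kappa_{1/2}=\frac{r(\epsilon+\tau/2)}{r(\epsilon+\tau)}$. Then there exist constants $\tilde\tau>0$, $C>0$ and an integer $\tilde N(\kappa,\kappa_0,\kappa_{1/2})$ such that $\det\frac{\partial \Pi u}{\partial x}>0$ on each of the finite elements whenever the mesh satisfies (on each layer) $\tau\le\tilde\tau$, $\epsilon\ge C\tau^2$ and $N\ge\tilde N(\kappa,\kappa_0,\kappa_{1/2})$. Moreover, $\tilde N^{-1}(\kappa,\kappa_0,\kappa_{1/2})\sim(\epsilon\tau)^{1/4}$, i.e. the two sides are bounded by each other up to positive constants independent of $\epsilon$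 and $\tau$ (for $\epsilon,\tau$ subject to these constraints).
   Context: Cavitation problem ($n=2$). Let $\omega>0$, $1<p<2$, and let $g:(0,\infty)\to[0,\infty)$ be continuously differentiable and strictly convex with $g(d)\to+\infty$ as $d\to0$ and $g(d)/d\to+\infty$ as $d\to+\infty$. Set $\Phi(v_1,v_2)=\omega(v_1^2+v_2^2)^{p/2}+g(v_1v_2)$. For $\lambda>1$ and $0\le\varrho<1$ consider minimizing $$I_\varrho(r)=\int_\varrho^1 R\,\Phi\Big(r'(R),\frac{r(R)}{R}\Big)\,dR$$ over $A^\lambda_\varrho=\{r\in W^{1,1}(\varrho,1): r(\varrho)>0,\ r(1)=\lambda,\ r'>0\text{ a.e.}\}$ (with $r(0)\ge 0$ in place of $r(\varrho)>0$ when $\varrho=0$). It is known that there is a unique minimizer $r_\varrho^\lambda\in C^2((\varrho,1])$, and that there is a constant $\lambda_c>1$ such that for $\varrho=0$ the minimizer satisfies $r_0^\lambda(0)>0$ if $\lambda>\lambda_c$ and is $r_0^\lambda(R)=\lambda R$ if $\lambda\le\lambda_c$. $\Omega_{(\epsilon,\tau)}=\{x\in\mathbb{R}^2:\epsilon\le|x|\le\epsilon+\tau\}$. Reference element: $\hat T=\{(\hat x_1,\hat x_2):\hat x_1,\hat x_2\ge 0,\ \hat x_1+\hat x_2\le 1\}$ with barycentric coordinates $\hat\lambda_1=1-\hat x_1-\hat x_2$, $\hat\lambda_2=\hat x_1$, $\hat\lambda_3=\hat x_2$, and quadratic shape functions $\hat\mu_i=\hat\lambda_i(2\hat\lambda_i-1)$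 ($1\le i\le 3$), $\hat\mu_{ij}=4\hat\lambda_i\hat\lambda_j$ ($1\le i<j\le 3$). Curved triangle: three vertices $a_1,a_2,a_3$ given in polar coordinates $a_i=(r(a_i),\theta(a_i))$ determine edge nodes $a_{ij}$ ($i<j$) with polar coordinates $\left(\frac{r(a_i)+r(a_j)}{2},\frac{\theta(a_i)+\theta(a_j)}{2}\right)$ (here $r(a_i)$ denotes the polar radius of $a_i$, not the cavity solution), and the mapping $x=F_T(\hat x)=\sum_{i=1}^3 a_i\hat\mu_i(\hat x)+\sum_{1\le i<j\le 3}a_{ij}\hat\mu_{ij}(\hat x)$; the element is $T=F_T(\hat T)$. Types A and B elements: for $i=0,1,\dots,N-1$, the type A element $A_i$ has vertices in polar coordinates (radius, angle) $a_1=(\epsilon,\tfrac{2i\pi}{N})$, $a_2=(\epsilon+\tau,\tfrac{(2i-1)\pi}{N})$, $a_3=(\epsilon+\tau,\tfrac{(2i+1)\pi}{N})$; the type B element $B_i$ has vertices $a_1=(\epsilon+\tau,\tfrac{(2i+1)\pi}{N})$, $a_2=(\epsilon,\tfrac{2(i+1)\pi}{N})$, $a_3=(\epsilon,\tfrac{2i\pi}{N})$. Interpolation: on the element $T$, $\Pi u(F_T(\hat x))=\sum_{i=1}^3 u(a_i)\hat\mu_i(\hat x)+\sum_{1\le i<j\le 3}u(a_{ij})\hat\mu_{ij}(\hat x)$. The determinant $\det\frac{\partial\Pi u}{\partial x}$ satisfies $\det\frac{\partial\Pi u}{\partial x}\cdot\det\frac{\partial x}{\partial\hat x}=\det\frac{\partial\Pi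 u}{\partial\hat x}$, and the mesh is required to be well defined, i.e. $\det\frac{\partial x}{\partial\hat x}>0$ on each element (for $N\ge\tilde N$ this is part of what is asserted). *)

theory Defs
  imports "HOL-Analysis.Analysis"
begin

section \<open>Smoothness and Sobolev functions on an interval\<close>

text \<open>Derivatives are taken within \<open>S\<close>, hence one-sided at the end points of a closed interval.\<close>

definition nderiv_within :: "real set \<Rightarrow> nat \<Rightarrow> (real \<Rightarrow> real) \<Rightarrow> real \<Rightarrow> real" where
  "nderiv_within S k f = ((\<lambda>h x. vector_derivative h (at x within S)) ^^ k) f"

definition smooth_within :: "real set \<Rightarrow> (real \<Rightarrow> real) \<Rightarrow> bool" where
  "smooth_within S f \<longleftrightarrow> (\<forall>k. \<forall>x\<in>S. nderiv_within S k f differentiable (at x within S))"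

definition test_function :: "real \<Rightarrow> real \<Rightarrow> (real \<Rightarrow> real) \<Rightarrow> bool" where
  "test_function a b \<phi> \<longleftrightarrow> smooth_within UNIV \<phi> \<and>
     (\<exists>c d. a < c \<and> d < b \<and> (\<forall>x. x \<notin> {c..d} \<longrightarrow> \<phi> x = 0))"

definition is_weak_deriv :: "real \<Rightarrow> real \<Rightarrow> (real \<Rightarrow> real) \<Rightarrow> (real \<Rightarrow> real) \<Rightarrow> bool" where
  "is_weak_deriv a b f f' \<longleftrightarrow> set_integrable lebesgue {a<..<b} f' \<and>
     (\<forall>\<phi>. test_function a b \<phi> \<longrightarrow>
        (LINT x:{a<..<b}|lebesgue. f x * deriv \<phi> x)
          = - (LINT x:{a<..<b}|lebesgue. f' x * \<phi> x))"

text \<open>Elements of \<open>W\<^sup>1\<^sup>,\<^sup>1(a,b)\<close> are represented by their representatives that are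
  continuous on the closed interval, so that boundary values are point values.\<close>

definition W11 :: "real \<Rightarrow> real \<Rightarrow> (real \<Rightarrow> real) set" where
  "W11 a b = {f. continuous_on {a..b} f \<and> (\<exists>f'. is_weak_deriv a b f f')}"

text \<open>The choice is unique up to a null set.\<close>

definition weak_deriv :: "real \<Rightarrow> real \<Rightarrow> (real \<Rightarrow> real) \<Rightarrow> real \<Rightarrow> real" where
  "weak_deriv a b f = (SOME f'. is_weak_deriv a b f f')"

definition strictly_convex_on :: "real set \<Rightarrow> (real \<Rightarrow> real) \<Rightarrow> bool" where
  "strictly_convex_on S f \<longleftrightarrow> convex S \<and>
     (\<forall>x\<in>S. \<forall>y\<in>S. \<forall>t. x \<noteq> y \<and> 0 < t \<and> t < 1 \<longrightarrow>
        f ((1 - t) * x + t * y) < (1 - t) * f x + t * f y)"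


section \<open>The radial cavitation problem\<close>

definition volumetric_energy :: "(real \<Rightarrow> real) \<Rightarrow> bool" where
  "volumetric_energy g \<longleftrightarrow> (\<forall>d>0. 0 \<le> g d) \<and> g C1_differentiable_on {0<..} \<and>
     strictly_convex_on {0<..} g \<and>
     filterlim g at_top (at_right 0) \<and> filterlim (\<lambda>d. g d / d) at_top at_top"

definition stored_energy :: "real \<Rightarrow> real \<Rightarrow> (real \<Rightarrow> real) \<Rightarrow> real \<Rightarrow> real \<Rightarrow> real" where
  "stored_energy \<omega> p g v1 v2 = \<omega> * (v1\<^sup>2 + v2\<^sup>2) powr (p / 2) + g (v1 * v2)"

text \<open>On the admissible class the integrand is nonnegative almost everywhere; the energy may be
  infinite.\<close>

definition radial_energy ::
  "real \<Rightarrow> real \<Rightarrow> (real \<Rightarrow> real) \<Rightarrow> real \<Rightarrow> (real \<Rightarrow> real) \<Rightarrow> ennreal" where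
  "radial_energy \<omega> p g \<rho> r =
     (\<integral>\<^sup>+R\<in>{\<rho><..<1}. ennreal (R * stored_energy \<omega> p g (weak_deriv \<rho> 1 r R) (r R / R)) \<partial>lebesgue)"

definition admissible :: "real \<Rightarrow> real \<Rightarrow> (real \<Rightarrow> real) set" where
  "admissible \<rho> lam = {r \<in> W11 \<rho> 1. (if \<rho> = 0 then 0 \<le> r 0 else 0 < r \<rho>) \<and> r 1 = lam \<and>
     (AE R in lebesgue. R \<in> {\<rho><..<1} \<longrightarrow> 0 < weak_deriv \<rho> 1 r R)}"

definition is_minimizer ::
  "real \<Rightarrow> real \<Rightarrow> (real \<Rightarrow> real) \<Rightarrow> real \<Rightarrow> real \<Rightarrow> (real \<Rightarrow> real) \<Rightarrow> bool" where
  "is_minimizer \<omega> p g \<rho> lam r \<longleftrightarrow> r \<in> admissible \<rho> lam \<and>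
     (\<forall>s\<in>admissible \<rho> lam. radial_energy \<omega> p g \<rho> r \<le> radial_energy \<omega> p g \<rho> s)"

definition critical_stretch :: "real \<Rightarrow> real \<Rightarrow> (real \<Rightarrow> real) \<Rightarrow> real \<Rightarrow> bool" where
  "critical_stretch \<omega> p g lam_c \<longleftrightarrow> 1 < lam_c \<and>
     (\<forall>lam>1. \<forall>r. is_minimizer \<omega> p g 0 lam r \<longrightarrow>
        (lam_c < lam \<longrightarrow> 0 < r 0) \<and> (lam \<le> lam_c \<longrightarrow> (\<forall>R\<in>{0..1}. r R = lam * R)))"

definition radial_map :: "(real \<Rightarrow> real) \<Rightarrow> real^2 \<Rightarrow> real^2" where
  "radial_map r x = (r (norm x) / norm x) *\<^sub>R x"


section \<open>Curved quadratic triangles\<close>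

definition ref_triangle :: "(real^2) set" where
  "ref_triangle = {x. 0 \<le> x $ 1 \<and> 0 \<le> x $ 2 \<and> x $ 1 + x $ 2 \<le> 1}"

definition bary :: "nat \<Rightarrow> real^2 \<Rightarrow> real" where
  "bary i x = (if i = 1 then 1 - x $ 1 - x $ 2 else if i = 2 then x $ 1 else x $ 2)"

definition shape_vertex :: "nat \<Rightarrow> real^2 \<Rightarrow> real" where
  "shape_vertex i x = bary i x * (2 * bary i x - 1)"

definition shape_edge :: "nat \<Rightarrow> nat \<Rightarrow> real^2 \<Rightarrow> real" where
  "shape_edge i j x = 4 * bary i x * bary j x"

text \<open>Nodes are pairs (radius, angle). The angle is kept as a real number, not reduced modulo
  \<open>2\<pi>\<close>, because edge nodes are obtained by averaging polar coordinates.\<close>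

type_synonym polar = "real \<times> real"

definition polar_point :: "polar \<Rightarrow> real^2" where
  "polar_point a = vector [fst a * cos (snd a), fst a * sin (snd a)]"

definition polar_mid :: "polar \<Rightarrow> polar \<Rightarrow> polar" where
  "polar_mid a b = ((fst a + fst b) / 2, (snd a + snd b) / 2)"

text \<open>A curved element is given by its vertices \<open>a 1, a 2, a 3\<close>; other indices are irrelevant.\<close>

type_synonym element = "nat \<Rightarrow> polar"

definition quad_combination :: "element \<Rightarrow> (polar \<Rightarrow> real^2) \<Rightarrow> real^2 \<Rightarrow> real^2" where
  "quad_combination a v x =
     (\<Sum>i\<in>{1..3}. shape_vertex i x *\<^sub>R v (a i))
     + (\<Sum>i\<in>{1..3}. \<Sum>j\<in>{i<..3}. shape_edge i j x *\<^sub>R v (polar_mid (a i) (a j)))"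

definition elem_map :: "element \<Rightarrow> real^2 \<Rightarrow> real^2" where
  "elem_map a = quad_combination a polar_point"

definition elem_set :: "element \<Rightarrow> (real^2) set" where
  "elem_set a = elem_map a ` ref_triangle"

text \<open>The interpolant is a function of the physical variable on \<open>elem_set a\<close>. If the Jacobian
  determinant of the quadratic map \<open>elem_map a\<close> is positive on the convex set \<open>ref_triangle\<close>, then
  that map is injective there, since the difference of two of its values is its derivative at the
  midpoint applied to the difference of the arguments.\<close>

definition interpolant :: "(real^2 \<Rightarrow> real^2) \<Rightarrow> element \<Rightarrow> real^2 \<Rightarrow> real^2" where
  "interpolant u a x =
     quad_combination a (\<lambda>b. u (polar_point b)) (inv_into ref_triangle (elem_map a) x)"

definition pos_jacobian_det :: "(real^2 \<Rightarrow> real^2) \<Rightarrow> (real^2) filter \<Rightarrow> bool" where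
  "pos_jacobian_det f F \<longleftrightarrow> (\<exists>D. (f has_derivative D) F \<and> 0 < det (matrix D))"


section \<open>Layered meshes of type A and type B elements\<close>

definition type_A :: "real \<Rightarrow> real \<Rightarrow> nat \<Rightarrow> nat \<Rightarrow> element" where
  "type_A \<epsilon> \<tau> N i k =
     (if k = 1 then (\<epsilon>, 2 * real i * pi / real N)
      else if k = 2 then (\<epsilon> + \<tau>, (2 * real i - 1) * pi / real N)
      else (\<epsilon> + \<tau>, (2 * real i + 1) * pi / real N))"

definition type_B :: "real \<Rightarrow> real \<Rightarrow> nat \<Rightarrow> nat \<Rightarrow> element" where
  "type_B \<epsilon> \<tau> N i k =
     (if k = 1 then (\<epsilon> + \<tau>, (2 * real i + 1) * pi / real N)
      else if k = 2 then (\<epsilon>, 2 * (real i + 1) * pi / real N)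
      else (\<epsilon>, 2 * real i * pi / real N))"

text \<open>The annulus between the radii \<open>inner_radius\<close> and \<open>inner_radius + thickness\<close>, cut into
  \<open>2 * sectors\<close> elements.\<close>

record layer =
  inner_radius :: real
  thickness :: real
  sectors :: nat

definition layer_elements :: "layer \<Rightarrow> element set" where
  "layer_elements L =
     type_A (inner_radius L) (thickness L) (sectors L) ` {..<sectors L}
     \<union> type_B (inner_radius L) (thickness L) (sectors L) ` {..<sectors L}"

text \<open>Layers are listed from the inside outwards and may touch but not overlap.\<close>

definition layered_mesh :: "real \<Rightarrow> layer list \<Rightarrow> bool" where
  "layered_mesh \<rho> Ls \<longleftrightarrow> Ls \<noteq> [] \<and>
     (\<forall>L\<in>set Ls. \<rho> \<le> inner_radius L \<and> 0 < thickness L \<and> inner_radius L + thickness L \<le> 1 \<and> 0 < sectors L) \<and>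
     sorted_wrt (\<lambda>K L. inner_radius K + thickness K \<le> inner_radius L) Ls"

text \<open>The arguments of \<open>N'\<close> are the ratios \<open>\<kappa>\<close>, \<open>\<kappa>\<^sub>0\<close>, \<open>\<kappa>\<^sub>1\<^sub>/\<^sub>2\<close> of the layer.\<close>

definition threshold_at ::
  "(real \<Rightarrow> real) \<Rightarrow> (real \<Rightarrow> real \<Rightarrow> real \<Rightarrow> nat) \<Rightarrow> real \<Rightarrow> real \<Rightarrow> nat" where
  "threshold_at r N' \<epsilon> \<tau> =
     N' (\<epsilon> / \<tau>) (r \<epsilon> / r (\<epsilon> + \<tau>)) (r (\<epsilon> + \<tau> / 2) / r (\<epsilon> + \<tau>))"

end

theory Submission
  imports Defs
begin

text \<open>
  Both the element map and the pulled-back interpolant are quadratic interpolants on the reference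
  triangle of a nodal field of the form \<open>f R\<close> times the unit vector in direction \<open>\<theta>\<close>: with \<open>f R = R\<close>
  for the geometry and \<open>f = r\<close> for the deformation. So one determinant has to be made positive for
  two increasing profiles \<open>f\<close>.

  By rotation invariance the symmetry axis of an element is the first coordinate axis. Let \<open>p\<close> be
  the value of \<open>f\<close> at the apex, \<open>q\<close> at the base, \<open>h\<close> at the middle radius, \<open>\<phi> = \<pi> / N\<close>,
  \<open>c = cos (\<phi> / 2)\<close>, \<open>\<sigma> = sin (\<phi> / 2)\<close>, \<open>s = \<lambda>\<^sub>2 + \<lambda>\<^sub>3\<close>, \<open>d = \<lambda>\<^sub>3 - \<lambda>\<^sub>2\<close>. The Jacobian determinant is
  \<open>4 \<sigma> (A B + 8 d\<^sup>2 q \<sigma>\<^sup>2 (q c - h))\<close> (\<open>det_quad_deriv_sector\<close>). Here \<open>A\<close> is the derivative in \<open>s\<close> of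
  the parabola through \<open>p, h, q\<close>, up to errors of order \<open>|q - h| \<sigma>\<^sup>2\<close> and \<open>q \<sigma>\<^sup>4\<close>, and \<open>B\<close> is close to
  \<open>q\<close>. A parabola interpolating a profile with \<open>f' \<ge> \<mu> > 0\<close> and bounded \<open>f''\<close> at three radii spanning
  \<open>\<tau>\<close> has slope (with respect to \<open>s\<close>) of size at least \<open>\<mu> \<tau> / 2\<close> if \<open>\<tau>\<close> is small (\<open>quad_slope_bounds\<close>). As \<open>|q - h|\<close> is
  of order \<open>\<tau>\<close>, everything is governed by the comparison of \<open>\<tau>\<close> with \<open>\<sigma>\<^sup>4\<close>, that is with \<open>N\<^sup>-\<^sup>4\<close>
  (\<open>sector_det_sign\<close>, \<open>thin_layers_det_pos\<close>). Type B elements have apex and base, and the sense of the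
  angle, interchanged; both \<open>A\<close> and \<open>\<sigma>\<close> change sign and the determinant stays positive.

  Positivity on the reference triangle passes to the physical element because a quadratic map
  satisfies \<open>F z - F y = F' ((y + z) / 2) (z - y)\<close>: the element map is injective on the triangle, its
  inverse is differentiable on the element, and the chain rule applies
  (\<open>pos_jacobian_det_interpolant\<close>).

  Since \<open>\<rho> \<le> \<epsilon> \<le> 1\<close>, the number \<open>\<tau>\<close> lies between \<open>\<rho> / \<kappa>\<close> and \<open>1 / \<kappa>\<close> for \<open>\<kappa> = \<epsilon> / \<tau>\<close>. Hence
  \<open>N\<^sup>4 \<ge> b \<kappa>\<close> with a large constant \<open>b\<close> makes \<open>N\<^sup>-\<^sup>4\<close> a small multiple of \<open>\<tau>\<close>, and \<open>\<kappa> powr (- 1 / 4)\<close> is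
  comparable to \<open>(\<epsilon> \<tau>) powr (1 / 4)\<close> because \<open>\<epsilon> \<tau> = \<epsilon>\<^sup>2 / \<kappa>\<close> (\<open>layer_sectors_asymp\<close>).
\<close>


section \<open>Quadratic interpolation on the reference triangle\<close>

lemma quad_combination_explicit:
  "quad_combination a v y =
     (let l1 = 1 - y $ 1 - y $ 2; l2 = y $ 1; l3 = y $ 2 in
      (l1 * (2 * l1 - 1)) *\<^sub>R v (a 1) + (l2 * (2 * l2 - 1)) *\<^sub>R v (a 2)
      + (l3 * (2 * l3 - 1)) *\<^sub>R v (a 3)
      + (4 * l1 * l2) *\<^sub>R v (polar_mid (a 1) (a 2)) + (4 * l1 * l3) *\<^sub>R v (polar_mid (a 1) (a 3))
      + (4 * l2 * l3) *\<^sub>R v (polar_mid (a 2) (a 3)))"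
proof -
  have "{1..3::nat} = {1, 2, 3}" "{1<..3::nat} = {2, 3}" "{2<..3::nat} = {3}" "{3<..3::nat} = {}"
    by auto
  then show ?thesis
    by (simp add: quad_combination_def shape_vertex_def shape_edge_def bary_def Let_def
        flip: One_nat_def)
qed

text \<open>Each summand is a node value times the directional derivative of its shape function; \<open>d1\<close>, \<open>d2\<close>,
  \<open>d3\<close> are the increments of the barycentric coordinates.\<close>

definition quad_deriv :: "element \<Rightarrow> (polar \<Rightarrow> real^2) \<Rightarrow> real^2 \<Rightarrow> real^2 \<Rightarrow> real^2" where
  "quad_deriv a v y h =
     (let l1 = 1 - y $ 1 - y $ 2; l2 = y $ 1; l3 = y $ 2; d1 = - h $ 1 - h $ 2; d2 = h $ 1; d3 = h $ 2 in
      ((4 * l1 - 1) * d1) *\<^sub>R v (a 1) + ((4 * l2 - 1) * d2) *\<^sub>R v (a 2)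
      + ((4 * l3 - 1) * d3) *\<^sub>R v (a 3)
      + (4 * (l1 * d2 + d1 * l2)) *\<^sub>R v (polar_mid (a 1) (a 2))
      + (4 * (l1 * d3 + d1 * l3)) *\<^sub>R v (polar_mid (a 1) (a 3))
      + (4 * (l2 * d3 + d2 * l3)) *\<^sub>R v (polar_mid (a 2) (a 3)))"

text \<open>For polynomials of degree two the mean value formula with the midpoint is exact. This is what
  turns an invertible derivative on a convex set into global injectivity.\<close>

lemma quad_combination_diff:
  "quad_combination a v z - quad_combination a v y
     = quad_deriv a v ((1 / 2) *\<^sub>R (y + z)) (z - y)"
proof -
  have vertex: "(4 * m - 1) * d = l * (2 * l - 1) - k * (2 * k - 1)"
    if "m = (k + l) / 2" "d = l - k" for m d k l :: real
    unfolding that by (simp add: field_simps)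
  have edge: "4 * (m * d' + d * m') = 4 * l * l' - 4 * k * k'"
    if "m = (k + l) / 2" "d = l - k" "m' = (k' + l') / 2" "d' = l' - k'" for m d k l m' d' k' l' :: real
    unfolding that by (simp add: field_simps)
  let ?l = "1 - z $ 1 - z $ 2" and ?k = "1 - y $ 1 - y $ 2"
  have "quad_deriv a v ((1 / 2) *\<^sub>R (y + z)) (z - y) =
      (?l * (2 * ?l - 1) - ?k * (2 * ?k - 1)) *\<^sub>R v (a 1)
      + (z $ 1 * (2 * z $ 1 - 1) - y $ 1 * (2 * y $ 1 - 1)) *\<^sub>R v (a 2)
      + (z $ 2 * (2 * z $ 2 - 1) - y $ 2 * (2 * y $ 2 - 1)) *\<^sub>R v (a 3)
      + (4 * ?l * z $ 1 - 4 * ?k * y $ 1) *\<^sub>R v (polar_mid (a 1) (a 2))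
      + (4 * ?l * z $ 2 - 4 * ?k * y $ 2) *\<^sub>R v (polar_mid (a 1) (a 3))
      + (4 * z $ 1 * z $ 2 - 4 * y $ 1 * y $ 2) *\<^sub>R v (polar_mid (a 2) (a 3))"
    unfolding quad_deriv_def Let_def
    by (intro arg_cong2 [where f = "(+)"] arg_cong2 [where f = scaleR] refl vertex edge)
       (simp_all add: field_simps)
  then show ?thesis
    unfolding quad_combination_explicit Let_def scaleR_left_diff_distrib
    by (simp only: add_diff_add)
qed

lemma quad_combination_has_derivative:
  "(quad_combination a v has_derivative quad_deriv a v y) (at y within S)"
proof -
  note [derivative_intros] = bounded_linear.has_derivative [OF bounded_linear_vec_nth]
  show ?thesis
    unfolding quad_combination_explicit [abs_def] quad_deriv_def [abs_def] Let_def
    by (intro has_derivative_add has_derivative_scaleR_left;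
        (rule derivative_eq_intros refl)+; simp add: fun_eq_iff algebra_simps)
qed

lemma linear_quad_deriv: "linear (quad_deriv a v y)"
  using has_derivative_linear [OF quad_combination_has_derivative] .

lemma det_quad_deriv:
  "det (matrix (quad_deriv a v y))
     = quad_deriv a v y (axis 1 1) $ 1 * quad_deriv a v y (axis 2 1) $ 2
       - quad_deriv a v y (axis 1 1) $ 2 * quad_deriv a v y (axis 2 1) $ 1"
  by (simp add: det_2 matrix_def)

lemma ref_triangle_bounds:
  assumes "y \<in> ref_triangle"
  shows "0 \<le> y $ 1" "0 \<le> y $ 2" "y $ 1 + y $ 2 \<le> 1"
  using assms by (auto simp: ref_triangle_def)

lemma compact_ref_triangle: "compact ref_triangle"
proof -
  have "closed ref_triangle"
    unfolding ref_triangle_def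
    by (intro closed_Collect_conj closed_Collect_le continuous_intros)
  moreover have "norm y \<le> 2" if "y \<in> ref_triangle" for y
  proof -
    have "norm y \<le> (\<Sum>i\<in>UNIV. \<bar>y $ i\<bar>)"
      by (rule norm_le_l1_cart)
    then show ?thesis
      using ref_triangle_bounds [OF that] by (simp add: sum_2)
  qed
  ultimately show ?thesis
    by (auto simp: compact_eq_bounded_closed bounded_iff)
qed

lemma inj_on_elem_map:
  assumes "\<And>y. y \<in> ref_triangle \<Longrightarrow> det (matrix (quad_deriv a polar_point y)) \<noteq> 0"
  shows "inj_on (elem_map a) ref_triangle"
proof (rule inj_onI)
  fix y z
  assume y: "y \<in> ref_triangle" and z: "z \<in> ref_triangle" and eq: "elem_map a y = elem_map a z"
  let ?m = "(1 / 2) *\<^sub>R (y + z)"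
  have "?m \<in> ref_triangle"
    using y z by (auto simp: ref_triangle_def field_simps)
  then have "inj (quad_deriv a polar_point ?m)"
    using assms det_nz_iff_inj [OF linear_quad_deriv] by blast
  moreover have "quad_deriv a polar_point ?m (z - y) = quad_deriv a polar_point ?m 0"
    using eq quad_combination_diff [of a polar_point z y] linear_0 [OF linear_quad_deriv]
    by (simp add: elem_map_def)
  ultimately have "z - y = 0"
    by (rule injD)
  then show "y = z"
    by simp
qed

text \<open>The interpolant is the composition of a quadratic map with the inverse of the element map, so its
  derivative is a quotient of two derivatives with positive determinant. The inverse is meaningful on
  the element only, hence the derivative within the element; it exists because the inverse is
  continuous there, by compactness of the reference triangle.\<close>

lemma pos_jacobian_det_interpolant:
  assumes F: "\<And>y. y \<in> ref_triangle \<Longrightarrow> 0 < det (matrix (quad_deriv a polar_point y))"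
    and P: "\<And>y. y \<in> ref_triangle \<Longrightarrow> 0 < det (matrix (quad_deriv a (\<lambda>b. u (polar_point b)) y))"
    and x: "x \<in> elem_set a"
  shows "pos_jacobian_det (interpolant u a) (at x within elem_set a)"
proof -
  let ?g = "inv_into ref_triangle (elem_map a)"
  have inj: "inj_on (elem_map a) ref_triangle"
    by (rule inj_on_elem_map) (use F in force)
  obtain y where y: "y \<in> ref_triangle" "x = elem_map a y"
    using x by (auto simp: elem_set_def)
  let ?F = "quad_deriv a polar_point y" and ?P = "quad_deriv a (\<lambda>b. u (polar_point b)) y"
  have "inj ?F"
    using F [OF y(1)] det_nz_iff_inj [OF linear_quad_deriv] by force
  then obtain G where G: "linear G" "G \<circ> ?F = id"
    using linear_injective_left_inverse [OF linear_quad_deriv] by blast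
  have dF: "(elem_map a has_derivative ?F) (at y within S)" for S
    unfolding elem_map_def by (rule quad_combination_has_derivative)
  have "continuous_on ref_triangle (elem_map a)"
    unfolding elem_map_def
    using quad_combination_has_derivative has_derivative_continuous_on by blast
  then have "continuous_on (elem_set a) ?g"
    unfolding elem_set_def
    by (rule continuous_on_inv) (auto simp: compact_ref_triangle inj)
  then have "(?g has_derivative G) (at (elem_map a y) within elem_map a ` ref_triangle)"
    using x y G inj
    by (intro has_derivative_inverse_within [OF dF])
       (auto simp: continuous_on_eq_continuous_within elem_set_def)
  then have dG: "(?g has_derivative G) (at x within elem_set a)"
    by (simp add: y elem_set_def)
  have "?g x = y"
    using y inj by simp
  then have "(interpolant u a has_derivative ?P \<circ> G) (at x within elem_set a)"
    unfolding interpolant_def [abs_def] comp_def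
    using has_derivative_compose [OF dG quad_combination_has_derivative] by metis
  moreover have "det (matrix G) * det (matrix ?F) = 1"
    using matrix_compose [OF linear_quad_deriv G(1), of a polar_point y] G(2)
    by (metis det_I det_mul matrix_id_mat_1)
  then have "0 < det (matrix G)"
    using F [OF y(1)] by (metis zero_less_mult_pos2 zero_less_one)
  then have "0 < det (matrix (?P \<circ> G))"
    using P [OF y(1)] by (simp add: matrix_compose [OF G(1) linear_quad_deriv] det_mul)
  ultimately show ?thesis
    unfolding pos_jacobian_det_def by blast
qed


section \<open>Slopes of interpolating parabolas\<close>

lemma mvt_within:
  fixes g g' :: "real \<Rightarrow> real"
  assumes "u < w" and "{u..w} \<subseteq> S"
    and g: "\<And>x. x \<in> S \<Longrightarrow> (g has_real_derivative g' x) (at x within S)"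
  obtains z where "z \<in> {u<..<w}" "g w - g u = g' z * (w - u)"
proof -
  have "(g has_derivative (*) (g' x)) (at x within {u..w})" if "u \<le> x" "x \<le> w" for x
    using DERIV_subset [OF g assms(2)] that assms(2) by (auto simp: has_field_derivative_def)
  from mvt_simple [OF assms(1) this] show thesis
    using that by blast
qed

text \<open>Up to the factor \<open>b - a\<close>, the right-hand sides are the end slopes of the parabola through the
  values of \<open>f\<close> at \<open>a\<close>, the midpoint and \<open>b\<close>. They are combinations \<open>3 S\<^sub>1 - S\<^sub>2\<close> and \<open>3 S\<^sub>2 - S\<^sub>1\<close>
  of the increments on the two halves, which almost agree if \<open>f''\<close> is bounded.\<close>

lemma quad_slope_bounds:
  fixes f f' f'' :: "real \<Rightarrow> real"
  assumes "a < b"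
    and "\<And>x. x \<in> {a..b} \<Longrightarrow> (f has_real_derivative f' x) (at x within {a..b})"
    and "\<And>x. x \<in> {a..b} \<Longrightarrow> (f' has_real_derivative f'' x) (at x within {a..b})"
    and "\<And>x. x \<in> {a..b} \<Longrightarrow> \<mu> \<le> f' x" "\<And>x. x \<in> {a..b} \<Longrightarrow> \<bar>f'' x\<bar> \<le> K"
  shows "(b - a) * (\<mu> - K * (b - a) / 2) \<le> - 3 * f a + 4 * f ((a + b) / 2) - f b"
    and "(b - a) * (\<mu> - K * (b - a) / 2) \<le> f a - 4 * f ((a + b) / 2) + 3 * f b"
proof -
  let ?h = "(a + b) / 2"
  have h: "a < ?h" "?h < b"
    using assms(1) by (auto simp: field_simps)
  obtain x where x: "x \<in> {a<..<?h}" "f ?h - f a = f' x * (?h - a)"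
    using mvt_within [of a ?h "{a..b}" f f'] h assms(2) by auto
  obtain y where y: "y \<in> {?h<..<b}" "f b - f ?h = f' y * (b - ?h)"
    using mvt_within [of ?h b "{a..b}" f f'] h assms(2) by auto
  have xy: "x < y" "{x..y} \<subseteq> {a..b}"
    using x y h by auto
  obtain z where z: "z \<in> {x<..<y}" "f' y - f' x = f'' z * (y - x)"
    using mvt_within [OF xy assms(3)] .
  have "\<bar>f' y - f' x\<bar> \<le> K * (b - a)"
    unfolding z(2) abs_mult using x y z h assms(5) [of z] by (intro mult_mono) auto
  moreover have "\<mu> \<le> f' x" "\<mu> \<le> f' y"
    using x y h assms(4) by auto
  ultimately have *: "2 * \<mu> - K * (b - a) \<le> 3 * f' x - f' y" "2 * \<mu> - K * (b - a) \<le> 3 * f' y - f' x"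
    by linarith+
  have d: "f ?h - f a = f' x * ((b - a) / 2)" "f b - f ?h = f' y * ((b - a) / 2)"
    using x(2) y(2) by (simp_all add: field_simps)
  have "- 3 * f a + 4 * f ?h - f b = (3 * f' x - f' y) * ((b - a) / 2)"
    "f a - 4 * f ?h + 3 * f b = (3 * f' y - f' x) * ((b - a) / 2)"
    unfolding left_diff_distrib mult.assoc d [symmetric] by simp_all
  moreover have "(b - a) * (\<mu> - K * (b - a) / 2) = (2 * \<mu> - K * (b - a)) * ((b - a) / 2)"
    by (simp add: field_simps)
  ultimately show "(b - a) * (\<mu> - K * (b - a) / 2) \<le> - 3 * f a + 4 * f ?h - f b"
    "(b - a) * (\<mu> - K * (b - a) / 2) \<le> f a - 4 * f ?h + 3 * f b"
    using * assms(1) by (metis diff_gt_0_iff_gt half_gt_zero mult_right_mono less_imp_le)+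
qed

lemma smooth_within_nderiv:
  assumes "smooth_within S f" "x \<in> S"
  shows "(nderiv_within S k f has_real_derivative nderiv_within S (Suc k) f x) (at x within S)"
  using assms vector_derivative_works [of "nderiv_within S k f" "at x within S"]
  by (simp add: smooth_within_def nderiv_within_def has_real_derivative_iff_has_vector_derivative)


section \<open>The Jacobian determinant of a sector\<close>

text \<open>The Jacobian determinant of an element, divided by \<open>4 \<sigma>\<close>, in the coordinates
  \<open>s = \<lambda>\<^sub>2 + \<lambda>\<^sub>3\<close> and \<open>d = \<lambda>\<^sub>3 - \<lambda>\<^sub>2\<close>. If \<open>X\<close>, \<open>Y\<close> are the components along and across the symmetry
  axis, then the first factor is \<open>\<partial>X / \<partial>s\<close>, the second one \<open>(\<partial>Y / \<partial>d) / (2 \<sigma>)\<close>, and the last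
  summand stems from the mixed product \<open>(\<partial>X / \<partial>d) (\<partial>Y / \<partial>s)\<close>. In the first factor
  \<open>q (1 - cos \<phi>) - 4 h (1 - c)\<close> is written as \<open>4 (q - h) (1 - c) - 2 q (1 - c)\<^sup>2\<close>, which shows that the
  terms of order \<open>\<phi>\<^sup>2\<close> cancel up to the difference \<open>q - h\<close>.\<close>

definition sector_det :: "real \<Rightarrow> real \<Rightarrow> real \<Rightarrow> real \<Rightarrow> real \<Rightarrow> real \<Rightarrow> real \<Rightarrow> real" where
  "sector_det p h q c \<sigma> s d =
     (p * (4 * s - 3) + 4 * h * (1 - 2 * s) + q * (4 * s - 1)
        + (1 - 2 * s) * (4 * (q - h) * (1 - c) - 2 * q * (1 - c)\<^sup>2))
     * (q * c * (2 * s - 1) + 2 * h * (1 - s))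
     + 8 * d\<^sup>2 * q * \<sigma>\<^sup>2 * (q * c - h)"

text \<open>The sign \<open>t\<close> is \<open>1\<close> if the base of the element is on its outer circle and \<open>-1\<close> if it is on the
  inner one. The first factor of the determinant, taken with this sign, is a convex combination of
  the end slopes minus at most \<open>4 t (q - h) \<sigma>\<^sup>2 + 2 q \<sigma>\<^sup>4\<close>. The second factor is at least \<open>q / 2\<close>. The
  mixed product costs at most \<open>8 q\<^sup>2 \<sigma>\<^sup>4\<close>, which is absorbed as another \<open>16 q \<sigma>\<^sup>4\<close> in the first factor;
  this adds up to the constant \<open>18\<close>.\<close>

lemma sector_det_sign:
  fixes t :: real
  assumes t: "t = 1 \<or> t = -1" and c: "1 / 2 \<le> c" and cs: "c\<^sup>2 + \<sigma>\<^sup>2 = 1"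
    and q: "0 < q" and h: "3 / 4 * q \<le> h" and tqh: "0 \<le> t * (q - h)"
    and sl0: "4 * (t * (q - h)) * \<sigma>\<^sup>2 + 18 * q * \<sigma> ^ 4 < t * (4 * h - 3 * p - q)"
    and sl1: "4 * (t * (q - h)) * \<sigma>\<^sup>2 + 18 * q * \<sigma> ^ 4 < t * (p - 4 * h + 3 * q)"
    and s: "0 \<le> s" "s \<le> 1" and d: "d\<^sup>2 \<le> 1"
  shows "0 < t * sector_det p h q c \<sigma> s d"
proof -
  define L where "L = t * (p * (4 * s - 3) + 4 * h * (1 - 2 * s) + q * (4 * s - 1))"
  define E where "E = t * (4 * (q - h) * (1 - c) - 2 * q * (1 - c)\<^sup>2)"
  define B where "B = q * c * (2 * s - 1) + 2 * h * (1 - s)"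
  have "c\<^sup>2 \<le> 1"
    using cs by (smt (verit) zero_le_power2)
  then have "c \<le> 1"
    using abs_square_le_1 [of c] by simp
  have "1 - c \<le> 1 - c\<^sup>2"
    using c \<open>c \<le> 1\<close> by (simp add: power2_eq_square mult_left_le)
  then have c': "1 - c \<le> \<sigma>\<^sup>2" "0 \<le> 1 - c"
    using cs \<open>c \<le> 1\<close> by linarith+
  then have c'': "(1 - c)\<^sup>2 \<le> \<sigma> ^ 4"
    using power_mono [OF c', of 2] by simp
  have tt: "t * t = 1" "\<bar>t\<bar> = 1"
    using t by auto
  have L: "4 * (t * (q - h)) * \<sigma>\<^sup>2 + 18 * q * \<sigma> ^ 4 < L"
  proof -
    have "L = (1 - s) * (t * (4 * h - 3 * p - q)) + s * (t * (p - 4 * h + 3 * q))"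
      by (simp add: L_def algebra_simps)
    moreover have "e < (1 - s) * x + s * z" if "e < x" "e < z" for e x z :: real
      using convex_bound_lt [of "- x" "- e" "- z" "1 - s" s] that s by simp
    ultimately show ?thesis
      using sl0 sl1 by metis
  qed
  have E: "\<bar>E\<bar> \<le> 4 * (t * (q - h)) * \<sigma>\<^sup>2 + 2 * q * \<sigma> ^ 4"
  proof -
    have "E = 4 * (t * (q - h)) * (1 - c) - t * (2 * q * (1 - c)\<^sup>2)"
      by (simp add: E_def algebra_simps)
    moreover have "\<bar>4 * (t * (q - h)) * (1 - c)\<bar> \<le> 4 * (t * (q - h)) * \<sigma>\<^sup>2"
      using mult_left_mono [OF c'(1) tqh] mult_nonneg_nonneg [OF tqh c'(2)] by simp
    moreover have "\<bar>t * (2 * q * (1 - c)\<^sup>2)\<bar> \<le> 2 * q * \<sigma> ^ 4"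
      using q c'' tt by (simp add: abs_mult mult_left_mono)
    ultimately show ?thesis
      by linarith
  qed
  have A: "16 * q * \<sigma> ^ 4 < L + (1 - 2 * s) * E"
  proof -
    have "\<bar>(1 - 2 * s) * E\<bar> \<le> \<bar>E\<bar>"
      using s by (simp add: abs_mult mult_left_le_one_le)
    then show ?thesis
      using L E by linarith
  qed
  have B: "q / 2 \<le> B"
  proof -
    have "q * c \<le> q"
      using q \<open>c \<le> 1\<close> by simp
    then have "q / 2 \<le> 2 * h - q * c"
      using h by linarith
    moreover have "q / 2 \<le> q * c"
      using q c by (simp add: field_simps)
    moreover have "B = (1 - s) * (2 * h - q * c) + s * (q * c)"
      by (simp add: B_def algebra_simps)
    moreover have "e \<le> (1 - s) * x + s * z" if "e \<le> x" "e \<le> z" for e x z :: real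
      using convex_bound_le [of "- x" "- e" "- z" "1 - s" s] that s by simp
    ultimately show ?thesis
      by metis
  qed
  \<comment> \<open>The mixed product is harmful only through \<open>1 - c\<close>, since \<open>t * (q - h)\<close> has the good sign.\<close>
  have "t * (h - q * c) \<le> q * \<sigma>\<^sup>2"
  proof -
    have "t * (h - q * c) = t * (q * (1 - c)) - t * (q - h)"
      by (simp add: algebra_simps)
    moreover have "t * (q * (1 - c)) \<le> q * (1 - c)"
      using t q c' by auto
    moreover have "q * (1 - c) \<le> q * \<sigma>\<^sup>2"
      using q c' by simp
    ultimately show ?thesis
      using tqh by linarith
  qed
  then have "8 * d\<^sup>2 * q * \<sigma>\<^sup>2 * (t * (h - q * c)) \<le> 8 * d\<^sup>2 * q * \<sigma>\<^sup>2 * (q * \<sigma>\<^sup>2)"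
    using q by (intro mult_left_mono) auto
  also have "\<dots> = d\<^sup>2 * (8 * q\<^sup>2 * \<sigma> ^ 4)"
    by (simp add: power2_eq_square power4_eq_xxxx)
  also have "\<dots> \<le> 8 * q\<^sup>2 * \<sigma> ^ 4"
    using d by (intro mult_left_le_one_le) auto
  also have "\<dots> = 16 * q * \<sigma> ^ 4 * (q / 2)"
    by (simp add: power2_eq_square)
  also have "\<dots> \<le> 16 * q * \<sigma> ^ 4 * B"
    using B q by (intro mult_left_mono) auto
  also have "\<dots> < (L + (1 - 2 * s) * E) * B"
    using A B q by (intro mult_strict_right_mono) auto
  finally show ?thesis
    by (simp add: sector_det_def L_def E_def B_def algebra_simps)
qed

text \<open>The vectors \<open>e\<close> and \<open>f\<close> point along and across the symmetry axis of the element. In this frame the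
  node values have the coordinates \<open>cos \<phi> = 2 c\<^sup>2 - 1\<close>, \<open>sin \<phi> = 2 \<sigma> c\<close>, so that the determinant becomes
  a polynomial identity modulo \<open>c\<^sup>2 + \<sigma>\<^sup>2 = 1\<close>.\<close>

lemma det_quad_deriv_frame:
  fixes C S :: real
  defines "e \<equiv> (vector [C, S] :: real^2)" and "f \<equiv> (vector [- S, C] :: real^2)"
  assumes CS: "C\<^sup>2 + S\<^sup>2 = 1" and cs: "c\<^sup>2 + \<sigma>\<^sup>2 = 1"
    and v: "v (a 1) = p *\<^sub>R e"
      "v (a 2) = q *\<^sub>R ((2 * c\<^sup>2 - 1) *\<^sub>R e - (2 * \<sigma> * c) *\<^sub>R f)"
      "v (a 3) = q *\<^sub>R ((2 * c\<^sup>2 - 1) *\<^sub>R e + (2 * \<sigma> * c) *\<^sub>R f)"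
      "v (polar_mid (a 1) (a 2)) = h *\<^sub>R (c *\<^sub>R e - \<sigma> *\<^sub>R f)"
      "v (polar_mid (a 1) (a 3)) = h *\<^sub>R (c *\<^sub>R e + \<sigma> *\<^sub>R f)"
      "v (polar_mid (a 2) (a 3)) = q *\<^sub>R e"
  shows "det (matrix (quad_deriv a v y)) =
    4 * \<sigma> * sector_det p h q c \<sigma> (y $ 1 + y $ 2) (y $ 2 - y $ 1)"
proof -
  define l2 l3 where l: "l2 = y $ 1" "l3 = y $ 2"
  \<comment> \<open>\<open>\<alpha>i\<close> and \<open>\<sigma> * \<beta>i\<close> are the frame coordinates of the two partial derivatives.\<close>
  define \<alpha>1 where "\<alpha>1 = (4 * l2 + 4 * l3 - 3) * p + (4 * l2 - 1) * (q * (2 * c\<^sup>2 - 1))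
    + 4 * (1 - 2 * l2 - l3) * (h * c) - 4 * l3 * (h * c) + 4 * l3 * q"
  define \<alpha>2 where "\<alpha>2 = (4 * l2 + 4 * l3 - 3) * p + (4 * l3 - 1) * (q * (2 * c\<^sup>2 - 1))
    - 4 * l2 * (h * c) + 4 * (1 - l2 - 2 * l3) * (h * c) + 4 * l2 * q"
  define \<beta>1 where "\<beta>1 = - (4 * l2 - 1) * (q * (2 * c)) - 4 * (1 - 2 * l2 - l3) * h - 4 * l3 * h"
  define \<beta>2 where "\<beta>2 = (4 * l3 - 1) * (q * (2 * c)) + 4 * l2 * h + 4 * (1 - l2 - 2 * l3) * h"
  have ax: "axis 1 1 $ 1 = (1::real)" "axis 1 1 $ (2::2) = (0::real)" "axis 2 1 $ (1::2) = (0::real)"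
    "axis 2 1 $ 2 = (1::real)"
    by (simp_all add: axis_def)
  have 1: "quad_deriv a v y (axis 1 1) = \<alpha>1 *\<^sub>R e + (\<sigma> * \<beta>1) *\<^sub>R f"
    unfolding quad_deriv_def v Let_def l [symmetric] \<alpha>1_def \<beta>1_def ax
    by (simp add: e_def f_def vec_eq_iff forall_2 algebra_simps)
  have 2: "quad_deriv a v y (axis 2 1) = \<alpha>2 *\<^sub>R e + (\<sigma> * \<beta>2) *\<^sub>R f"
    unfolding quad_deriv_def v Let_def l [symmetric] \<alpha>2_def \<beta>2_def ax
    by (simp add: e_def f_def vec_eq_iff forall_2 algebra_simps)
  have "det (matrix (quad_deriv a v y)) = \<sigma> * (\<alpha>1 * \<beta>2 - \<alpha>2 * \<beta>1) * (C\<^sup>2 + S\<^sup>2)"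
    unfolding det_quad_deriv 1 2 e_def f_def by (simp add: algebra_simps power2_eq_square)
  moreover have "\<alpha>1 * \<beta>2 - \<alpha>2 * \<beta>1 = 4 * sector_det p h q c \<sigma> (l2 + l3) (l3 - l2)"
  proof -
    have "\<sigma>\<^sup>2 = 1 - c\<^sup>2"
      using cs by simp
    then show ?thesis
      unfolding sector_det_def \<alpha>1_def \<alpha>2_def \<beta>1_def \<beta>2_def
      by (simp only:) (simp add: algebra_simps power2_eq_square)
  qed
  ultimately show ?thesis
    by (simp add: CS l)
qed

text \<open>The form shared by the identity, with \<open>f R = R\<close>, and a radial deformation. Nodes are
  parametrized by polar coordinates, and the radii are restricted to \<open>X\<close>, because \<open>radial_map\<close> has the
  required form at positive radii only.\<close>

definition radial_nodal :: "(real \<Rightarrow> real) \<Rightarrow> real set \<Rightarrow> (polar \<Rightarrow> real^2) \<Rightarrow> bool" where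
  "radial_nodal f X v \<longleftrightarrow> (\<forall>R\<in>X. \<forall>\<theta>. v (R, \<theta>) = f R *\<^sub>R polar_point (1, \<theta>))"

lemma det_quad_deriv_sector:
  assumes v: "radial_nodal f X v" and X: "R1 \<in> X" "(R1 + R2) / 2 \<in> X" "R2 \<in> X"
    and a: "a 1 = (R1, \<theta>)" "a 2 = (R2, \<theta> - \<phi>)" "a 3 = (R2, \<theta> + \<phi>)"
  shows "det (matrix (quad_deriv a v y)) =
        4 * sin (\<phi> / 2) *
    sector_det (f R1) (f ((R1 + R2) / 2)) (f R2) (cos (\<phi> / 2)) (sin (\<phi> / 2))
      (y $ 1 + y $ 2) (y $ 2 - y $ 1)"
proof (rule det_quad_deriv_frame [where C = "cos \<theta>" and S = "sin \<theta>"])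
  let ?c = "cos (\<phi> / 2)" and ?s = "sin (\<phi> / 2)"
  have d: "cos \<phi> = 2 * ?c\<^sup>2 - 1" "sin \<phi> = 2 * ?s * ?c"
    using cos_double_cos [of "\<phi> / 2"] sin_double [of "\<phi> / 2"] by simp_all
  have mid: "polar_mid (R1, \<theta>) (R2, \<theta> - \<phi>) = ((R1 + R2) / 2, \<theta> - \<phi> / 2)"
    "polar_mid (R1, \<theta>) (R2, \<theta> + \<phi>) = ((R1 + R2) / 2, \<theta> + \<phi> / 2)"
    "polar_mid (R2, \<theta> - \<phi>) (R2, \<theta> + \<phi>) = (R2, \<theta>)"
    by (simp_all add: polar_mid_def field_simps)
  note v' = v [unfolded radial_nodal_def, rule_format]
  show "v (a 1) = f R1 *\<^sub>R vector [cos \<theta>, sin \<theta>]"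
    "v (a 2) = f R2 *\<^sub>R ((2 * ?c\<^sup>2 - 1) *\<^sub>R vector [cos \<theta>, sin \<theta>] - (2 * ?s * ?c) *\<^sub>R vector [- sin \<theta>, cos \<theta>])"
    "v (a 3) = f R2 *\<^sub>R ((2 * ?c\<^sup>2 - 1) *\<^sub>R vector [cos \<theta>, sin \<theta>] + (2 * ?s * ?c) *\<^sub>R vector [- sin \<theta>, cos \<theta>])"
    "v (polar_mid (a 1) (a 2)) = f ((R1 + R2) / 2) *\<^sub>R (?c *\<^sub>R vector [cos \<theta>, sin \<theta>] - ?s *\<^sub>R vector [- sin \<theta>, cos \<theta>])"
    "v (polar_mid (a 1) (a 3)) = f ((R1 + R2) / 2) *\<^sub>R (?c *\<^sub>R vector [cos \<theta>, sin \<theta>] + ?s *\<^sub>R vector [- sin \<theta>, cos \<theta>])"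
    "v (polar_mid (a 2) (a 3)) = f R2 *\<^sub>R vector [cos \<theta>, sin \<theta>]"
    unfolding a mid d [symmetric]
    by (simp_all add: v' X polar_point_def vec_eq_iff forall_2 cos_add sin_add cos_diff sin_diff algebra_simps)
qed simp_all

text \<open>Type A has its apex at the inner radius and \<open>t = 1\<close>. Type B has its apex at the outer radius and
  its base nodes run clockwise around the axis; this is the same computation with \<open>- \<phi>\<close> in place of
  \<open>\<phi>\<close> and \<open>t = -1\<close>. The error term assumed here dominates that of both types.\<close>

lemma layer_elements_det_pos:
  fixes f :: "real \<Rightarrow> real"
  assumes L: "0 < sectors L"
  defines "R0 \<equiv> inner_radius L" and "R1 \<equiv> inner_radius L + thickness L"
  defines "Rh \<equiv> (R0 + R1) / 2" and "\<sigma> \<equiv> sin (pi / real (sectors L) / 2)"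
  assumes f: "0 < f R0" "f R0 \<le> f Rh" "f Rh \<le> f R1" "3 / 4 * f R1 \<le> f Rh" and \<sigma>: "\<sigma>\<^sup>2 \<le> 3 / 4"
    and sl0: "4 * (f R1 - f R0) * \<sigma>\<^sup>2 + 18 * f R1 * \<sigma> ^ 4 < - 3 * f R0 + 4 * f Rh - f R1"
    and sl1: "4 * (f R1 - f R0) * \<sigma>\<^sup>2 + 18 * f R1 * \<sigma> ^ 4 < f R0 - 4 * f Rh + 3 * f R1"
    and v: "radial_nodal f {R0, Rh, R1} v"
    and a: "a \<in> layer_elements L" and y: "y \<in> ref_triangle"
  shows "0 < det (matrix (quad_deriv a v y))"
proof -
  let ?N = "real (sectors L)"
  define \<phi> where "\<phi> = pi / ?N"
  define c where "c = cos (\<phi> / 2)"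
  have \<phi>: "0 < \<phi>" "\<phi> \<le> pi"
    using L by (auto simp: \<phi>_def divide_le_eq)
  have \<sigma>0: "0 < \<sigma>"
    unfolding \<sigma>_def \<phi>_def [symmetric] using \<phi> by (intro sin_gt_zero) auto
  have cs: "c\<^sup>2 + \<sigma>\<^sup>2 = 1"
    by (simp add: c_def \<sigma>_def \<phi>_def)
  have "0 \<le> c"
    unfolding c_def using \<phi> by (intro cos_ge_zero) auto
  moreover have "(1 / 2)\<^sup>2 \<le> c\<^sup>2"
    using cs \<sigma> by (simp add: power2_eq_square)
  ultimately have c: "1 / 2 \<le> c"
    by (rule power2_le_imp_le[rotated])
  have y': "0 \<le> y $ 1 + y $ 2" "y $ 1 + y $ 2 \<le> 1" "(y $ 2 - y $ 1)\<^sup>2 \<le> 1"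
    using y by (auto simp: ref_triangle_def abs_square_le_1)
  have s0: "4 * (f R1 - f Rh) * \<sigma>\<^sup>2 + 18 * f R1 * \<sigma> ^ 4 \<le> 4 * (f R1 - f R0) * \<sigma>\<^sup>2 + 18 * f R1 * \<sigma> ^ 4"
    using f by (intro add_mono mult_right_mono) auto
  have s1: "4 * (f Rh - f R0) * \<sigma>\<^sup>2 + 18 * f R0 * \<sigma> ^ 4 \<le> 4 * (f R1 - f R0) * \<sigma>\<^sup>2 + 18 * f R1 * \<sigma> ^ 4"
    using f by (intro add_mono mult_right_mono) auto
  consider (A) i where "a = type_A R0 (thickness L) (sectors L) i"
    | (B) i where "a = type_B R0 (thickness L) (sectors L) i"
    using a by (auto simp: layer_elements_def R0_def)
  then show ?thesis
  proof cases
    case A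
    define \<theta> where "\<theta> = 2 * real i * pi / ?N"
    have "a 1 = (R0, \<theta>)" "a 2 = (R1, \<theta> - \<phi>)" "a 3 = (R1, \<theta> + \<phi>)"
      by (simp_all add: A type_A_def R0_def R1_def \<theta>_def \<phi>_def field_simps diff_divide_distrib add_divide_distrib)
    then have "det (matrix (quad_deriv a v y)) =
        4 * \<sigma> * sector_det (f R0) (f Rh) (f R1) c \<sigma> (y $ 1 + y $ 2) (y $ 2 - y $ 1)"
      unfolding \<sigma>_def c_def Rh_def \<phi>_def [symmetric]
      by (rule det_quad_deriv_sector [OF v, rotated 3]) (auto simp: Rh_def)
    moreover have "0 < 1 * sector_det (f R0) (f Rh) (f R1) c \<sigma> (y $ 1 + y $ 2) (y $ 2 - y $ 1)"
      using f sl0 sl1 s0 by (intro sector_det_sign c cs y') auto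
    ultimately show ?thesis
      using \<sigma>0 by simp
  next
    case B
    define \<theta> where "\<theta> = (2 * real i + 1) * pi / ?N"
    have "a 1 = (R1, \<theta>)" "a 2 = (R0, \<theta> - (- \<phi>))" "a 3 = (R0, \<theta> + (- \<phi>))"
      by (simp_all add: B type_B_def R0_def R1_def \<theta>_def \<phi>_def field_simps diff_divide_distrib add_divide_distrib)
    then have "det (matrix (quad_deriv a v y)) =
        4 * sin (- \<phi> / 2) * sector_det (f R1) (f ((R1 + R0) / 2)) (f R0) (cos (- \<phi> / 2)) (sin (- \<phi> / 2))
          (y $ 1 + y $ 2) (y $ 2 - y $ 1)"
      by (rule det_quad_deriv_sector [OF v, rotated 3]) (auto simp: Rh_def add.commute)
    then have "det (matrix (quad_deriv a v y)) =
        4 * \<sigma> * (- 1 * sector_det (f R1) (f Rh) (f R0) c (- \<sigma>) (y $ 1 + y $ 2) (y $ 2 - y $ 1))"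
      by (simp add: \<sigma>_def c_def Rh_def \<phi>_def add.commute)
    moreover have "0 < - 1 * sector_det (f R1) (f Rh) (f R0) c (- \<sigma>) (y $ 1 + y $ 2) (y $ 2 - y $ 1)"
      using f sl0 sl1 s1 cs by (intro sector_det_sign c y') auto
    ultimately show ?thesis
      using \<sigma>0 by (metis mult_pos_pos zero_less_numeral)
  qed
qed

text \<open>On a layer of thickness \<open>\<tau>\<close> the end slopes are at least \<open>\<mu> \<tau> / 2\<close>, whereas the error terms are
  bounded by a constant times \<open>\<delta> \<tau>\<close>: increments of \<open>f\<close> are of order \<open>\<tau>\<close>, and the assumption on the
  number of sectors gives \<open>\<sigma>\<^sup>4 \<le> 16 \<delta> \<tau>\<close> and \<open>\<sigma>\<^sup>2 \<le> 4 \<delta>\<close>.\<close>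

lemma thin_layers_det_pos:
  fixes f f' f'' :: "real \<Rightarrow> real"
  assumes f: "\<And>x. x \<in> {\<rho>..1} \<Longrightarrow> (f has_real_derivative f' x) (at x within {\<rho>..1})"
    and f': "\<And>x. x \<in> {\<rho>..1} \<Longrightarrow> (f' has_real_derivative f'' x) (at x within {\<rho>..1})"
    and pos: "\<And>x. x \<in> {\<rho>..1} \<Longrightarrow> 0 < f x" "\<And>x. x \<in> {\<rho>..1} \<Longrightarrow> 0 < f' x"
    and f'': "\<And>x. x \<in> {\<rho>..1} \<Longrightarrow> \<bar>f'' x\<bar> \<le> K" and "\<rho> < 1"
  shows "\<exists>\<delta>>0. \<forall>L. \<rho> \<le> inner_radius L \<and> 0 < thickness L \<and> thickness L \<le> \<delta> \<and>
      inner_radius L + thickness L \<le> 1 \<and> 0 < sectors L \<and> 1 / real (sectors L) ^ 4 \<le> \<delta> * thickness L \<longrightarrow>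
      (\<forall>v. radial_nodal f {\<rho>..1} v \<longrightarrow>
        (\<forall>a\<in>layer_elements L. \<forall>y\<in>ref_triangle. 0 < det (matrix (quad_deriv a v y))))"
proof -
  have cont: "continuous_on {\<rho>..1} f" "continuous_on {\<rho>..1} f'"
    using f f' by (meson DERIV_continuous_on)+
  have ne: "{\<rho>..1} \<noteq> {}"
    using \<open>\<rho> < 1\<close> by simp
  obtain \<mu> where \<mu>: "0 < \<mu>" "\<And>x. x \<in> {\<rho>..1} \<Longrightarrow> \<mu> \<le> f' x"
    using continuous_attains_inf [OF compact_Icc ne cont(2)] pos(2) by blast
  obtain k where k: "0 < k" "\<And>x. x \<in> {\<rho>..1} \<Longrightarrow> k \<le> f x"
    using continuous_attains_inf [OF compact_Icc ne cont(1)] pos(1) by blast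
  obtain S1 where S1: "\<And>x. x \<in> {\<rho>..1} \<Longrightarrow> f x \<le> S1"
    using continuous_attains_sup [OF compact_Icc ne cont(1)] by blast
  obtain S2 where S2: "\<And>x. x \<in> {\<rho>..1} \<Longrightarrow> f' x \<le> S2"
    using continuous_attains_sup [OF compact_Icc ne cont(2)] by blast
  define S where "S = max S1 S2"
  have S: "f x \<le> S" "f' x \<le> S" if "x \<in> {\<rho>..1}" for x
    using S1 [OF that] S2 [OF that] by (auto simp: S_def)
  have "0 < S" "0 \<le> K"
    using S(1) [of 1] pos(1) [of 1] f'' [of 1] \<open>\<rho> < 1\<close> by auto
  (* The four bounds serve, in this order: the error terms, which add up to 304 S \<delta> \<tau>; the slopes;
     the lower bound for the middle value in terms of the outer one; the cosine being at least 1/2. *)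
  define \<delta> where "\<delta> = min (min (\<mu> / (1000 * S)) (\<mu> / (K + 1))) (min (k / (4 * S)) (3 / 16))"
  have \<delta>: "0 < \<delta>" "1000 * S * \<delta> \<le> \<mu>" "(K + 1) * \<delta> \<le> \<mu>" "4 * S * \<delta> \<le> k" "\<delta> \<le> 3 / 16"
  proof -
    show "0 < \<delta>"
      using \<open>0 < S\<close> \<open>0 \<le> K\<close> \<mu> k by (simp add: \<delta>_def)
    have "\<delta> \<le> \<mu> / (1000 * S)" "\<delta> \<le> \<mu> / (K + 1)" "\<delta> \<le> k / (4 * S)" "\<delta> \<le> 3 / 16"
      unfolding \<delta>_def by linarith+
    then show "1000 * S * \<delta> \<le> \<mu>" "(K + 1) * \<delta> \<le> \<mu>" "4 * S * \<delta> \<le> k" "\<delta> \<le> 3 / 16"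
      using \<open>0 < S\<close> \<open>0 \<le> K\<close> by (simp_all add: field_simps)
  qed
  show ?thesis
  proof (intro exI [of _ \<delta>] conjI allI impI ballI \<delta>(1))
    fix L v a y
    assume "\<rho> \<le> inner_radius L \<and> 0 < thickness L \<and> thickness L \<le> \<delta> \<and>
      inner_radius L + thickness L \<le> 1 \<and> 0 < sectors L \<and> 1 / real (sectors L) ^ 4 \<le> \<delta> * thickness L"
      and v: "radial_nodal f {\<rho>..1} v" and a: "a \<in> layer_elements L" and y: "y \<in> ref_triangle"
    moreover define \<tau> R0 R1 where d: "\<tau> = thickness L" "R0 = inner_radius L" "R1 = R0 + \<tau>"
    ultimately have L: "\<rho> \<le> R0" "0 < \<tau>" "\<tau> \<le> \<delta>" "R1 \<le> 1" "0 < sectors L" "1 / real (sectors L) ^ 4 \<le> \<delta> * \<tau>"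
      by auto
    define Rh \<sigma> where e: "Rh = (R0 + R1) / 2" "\<sigma> = sin (pi / real (sectors L) / 2)"
    have Rs: "R0 \<in> {\<rho>..1}" "Rh \<in> {\<rho>..1}" "R1 \<in> {\<rho>..1}" "R0 < Rh" "Rh < R1"
      using L by (auto simp: d e)
    have mono: "0 \<le> f w - f u \<and> f w - f u \<le> S * (w - u)" if uw: "u < w" "\<rho> \<le> u" "w \<le> 1" for u w
    proof -
      have sub: "{u..w} \<subseteq> {\<rho>..1}"
        using uw by auto
      obtain z where z: "z \<in> {u<..<w}" "f w - f u = f' z * (w - u)"
        using mvt_within [OF uw(1) sub f] .
      then show ?thesis
        using uw pos(2) [of z] S(2) [of z] by (auto intro!: mult_right_mono)
    qed
    have inc: "f R0 \<le> f Rh" "f Rh \<le> f R1" "f R1 - f R0 \<le> S * \<tau>" "f R1 - f Rh \<le> S * \<tau>"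
    proof -
      show "f R0 \<le> f Rh" "f Rh \<le> f R1" "f R1 - f R0 \<le> S * \<tau>"
        using mono [of R0 Rh] mono [of Rh R1] mono [of R0 R1] Rs by (auto simp: d)
      then show "f R1 - f Rh \<le> S * \<tau>"
        by linarith
    qed
    have "S * \<tau> \<le> S * \<delta>"
      using L(3) \<open>0 < S\<close> by simp
    then have "S * \<tau> \<le> k / 4"
      using \<delta>(4) by linarith
    then have h: "3 / 4 * f R1 \<le> f Rh"
      using inc(4) k(2) [OF Rs(3)] by linarith
    have \<sigma>4: "\<sigma> ^ 4 \<le> 16 * (\<delta> * \<tau>)"
    proof -
      have "0 < pi / real (sectors L) / 2" "pi / real (sectors L) / 2 \<le> pi"
        using L(5) by (auto simp: divide_le_eq)
      then have "0 \<le> \<sigma>" "\<sigma> \<le> pi / real (sectors L) / 2"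
        unfolding e by (auto intro: sin_ge_zero sin_x_le_x)
      moreover have "pi / real (sectors L) / 2 \<le> 2 * (1 / real (sectors L))"
        using pi_less_4 L(5) by (simp add: field_simps)
      ultimately have "\<sigma> ^ 4 \<le> (2 * (1 / real (sectors L))) ^ 4"
        by (intro power_mono) auto
      also have "\<dots> = 16 * (1 / real (sectors L) ^ 4)"
        by (simp add: power_mult_distrib power_divide)
      finally show ?thesis
        using L(6) by linarith
    qed
    have \<sigma>2: "\<sigma>\<^sup>2 \<le> 4 * \<delta>"
    proof (rule power2_le_imp_le)
      have "\<delta> * \<tau> \<le> \<delta> * \<delta>"
        using L(3) \<delta>(1) by simp
      then show "(\<sigma>\<^sup>2)\<^sup>2 \<le> (4 * \<delta>)\<^sup>2"
        using \<sigma>4 by (simp add: power2_eq_square power4_eq_xxxx)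
    qed (use \<delta> in auto)
    have err: "4 * (f R1 - f R0) * \<sigma>\<^sup>2 + 18 * f R1 * \<sigma> ^ 4 < \<tau> * (\<mu> / 2)"
    proof -
      have "4 * (f R1 - f R0) * \<sigma>\<^sup>2 \<le> 4 * (S * \<tau>) * (4 * \<delta>)"
        using inc \<sigma>2 \<delta>(1) \<open>0 < S\<close> L(2) by (intro mult_mono) auto
      moreover have "18 * f R1 * \<sigma> ^ 4 \<le> 18 * S * (16 * (\<delta> * \<tau>))"
        using \<sigma>4 S(1) [OF Rs(3)] pos(1) [OF Rs(3)] \<open>0 < S\<close> by (intro mult_mono) auto
      moreover have "\<tau> * (304 * (S * \<delta>)) < \<tau> * (\<mu> / 2)"
        using \<delta>(2) L(2) \<mu>(1) by (intro mult_strict_left_mono) auto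
      ultimately show ?thesis
        by (simp add: algebra_simps)
    qed
    have "K * \<tau> \<le> \<mu>"
      using mult_mono [of K "K + 1" \<tau> \<delta>] L \<open>0 \<le> K\<close> \<delta>(3) by simp
    then have "\<tau> * (\<mu> / 2) \<le> (R1 - R0) * (\<mu> - K * (R1 - R0) / 2)"
      using L(2) by (simp add: d)
    moreover have sub: "x \<in> {\<rho>..1}" "{R0..R1} \<subseteq> {\<rho>..1}" if "x \<in> {R0..R1}" for x
      using that Rs by auto
    have "(R1 - R0) * (\<mu> - K * (R1 - R0) / 2) \<le> - 3 * f R0 + 4 * f Rh - f R1"
      "(R1 - R0) * (\<mu> - K * (R1 - R0) / 2) \<le> f R0 - 4 * f Rh + 3 * f R1"
      unfolding e using Rs(4,5)
      by (intro quad_slope_bounds [where f' = f' and f'' = f''] DERIV_subset [OF f] DERIV_subset [OF f'] \<mu>(2) f'' sub;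
          simp)+
    ultimately have sl: "\<tau> * (\<mu> / 2) \<le> - 3 * f R0 + 4 * f Rh - f R1"
      "\<tau> * (\<mu> / 2) \<le> f R0 - 4 * f Rh + 3 * f R1"
      by linarith+
    have nodal: "radial_nodal f {R0, Rh, R1} v"
      using v Rs by (auto simp: radial_nodal_def)
    have \<sigma>34: "\<sigma>\<^sup>2 \<le> 3 / 4"
      using \<sigma>2 \<delta>(5) by linarith
    show "0 < det (matrix (quad_deriv a v y))"
      using layer_elements_det_pos [OF L(5), folded d(1,2), folded d(3), folded e,
          OF pos(1) [OF Rs(1)] inc(1,2) h \<sigma>34 less_le_trans [OF err sl(1)] less_le_trans [OF err sl(2)]
            nodal a y] .
  qed
qed


section \<open>The number of sectors\<close>

definition layer_sectors :: "real \<Rightarrow> real \<Rightarrow> nat" where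
  "layer_sectors b \<kappa> = nat \<lceil>(b * \<kappa>) powr (1 / 4)\<rceil>"

lemma fourth_power_layer_sectors:
  assumes "0 < b" "0 < \<kappa>" "layer_sectors b \<kappa> \<le> n"
  shows "b * \<kappa> \<le> real n ^ 4"
proof -
  have "(b * \<kappa>) powr (1 / 4) \<le> real n"
    using assms(3) unfolding layer_sectors_def by linarith
  then have "((b * \<kappa>) powr (1 / 4)) ^ 4 \<le> real n ^ 4"
    by (intro power_mono) auto
  moreover have "((b * \<kappa>) powr (1 / 4)) ^ 4 = b * \<kappa>"
    using assms by (simp add: powr_powr flip: powr_numeral)
  ultimately show ?thesis
    by simp
qed

text \<open>Here \<open>(\<epsilon> \<tau>) powr (1 / 4) * \<kappa> powr (1 / 4) = \<epsilon> powr (1 / 2)\<close> with \<open>\<rho> \<le> \<epsilon> \<le> 1\<close>. Rounding up does no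
  harm because \<open>\<kappa> \<ge> \<rho>\<close> is bounded away from zero.\<close>

lemma layer_sectors_asymp:
  assumes "0 < b" "0 < \<rho>"
  shows "\<exists>c1>0. \<exists>c2>0. \<forall>\<epsilon> \<tau>. \<rho> \<le> \<epsilon> \<and> 0 < \<tau> \<and> \<epsilon> \<le> 1 \<and> \<tau> \<le> 1 \<longrightarrow>
      c1 * (\<epsilon> * \<tau>) powr (1 / 4) \<le> 1 / real (layer_sectors b (\<epsilon> / \<tau>)) \<and>
      1 / real (layer_sectors b (\<epsilon> / \<tau>)) \<le> c2 * (\<epsilon> * \<tau>) powr (1 / 4)"
proof -
  define c1 where "c1 = 1 / (b powr (1 / 4) + \<rho> powr - (1 / 4))"
  define c2 where "c2 = 1 / (b powr (1 / 4) * \<rho> powr (1 / 2))"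
  have c: "0 < c1" "0 < c2"
    using assms by (auto simp: c1_def c2_def intro!: divide_pos_pos add_pos_nonneg)
  moreover have "c1 * (\<epsilon> * \<tau>) powr (1 / 4) \<le> 1 / real (layer_sectors b (\<epsilon> / \<tau>)) \<and>
      1 / real (layer_sectors b (\<epsilon> / \<tau>)) \<le> c2 * (\<epsilon> * \<tau>) powr (1 / 4)"
    if et: "\<rho> \<le> \<epsilon>" "0 < \<tau>" "\<epsilon> \<le> 1" "\<tau> \<le> 1" for \<epsilon> \<tau>
  proof -
    let ?x = "(\<epsilon> / \<tau>) powr (1 / 4)" and ?N = "real (layer_sectors b (\<epsilon> / \<tau>))"
    have "0 < \<epsilon>"
      using et assms by linarith
    have bx: "(b * (\<epsilon> / \<tau>)) powr (1 / 4) = b powr (1 / 4) * ?x"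
      by (rule powr_mult)
    have x: "0 < ?x" "0 < b powr (1 / 4)"
      using assms et \<open>0 < \<epsilon>\<close> by auto
    have N: "b powr (1 / 4) * ?x \<le> ?N" "?N \<le> b powr (1 / 4) * ?x + 1"
      using x unfolding layer_sectors_def bx by (auto simp: of_nat_nat intro: less_imp_le)
    then have "0 < ?N"
      using x by (meson less_le_trans mult_pos_pos)
    have prod: "(\<epsilon> * \<tau>) powr (1 / 4) * ?x = \<epsilon> powr (1 / 2)"
    proof -
      have "(\<epsilon> * \<tau>) powr (1 / 4) * ?x = (\<epsilon> powr 2) powr (1 / 4)"
        using et \<open>0 < \<epsilon>\<close> by (subst powr_mult [symmetric]) (auto simp: power2_eq_square)
      then show ?thesis
        by (simp add: powr_powr)
    qed
    have lower: "?N \<le> ?x / c1"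
    proof -
      have "\<rho> \<le> \<epsilon> / \<tau>"
        using et \<open>0 < \<epsilon>\<close> mult_mono [of \<rho> \<epsilon> \<tau> 1] by (simp add: le_divide_eq)
      then have "\<rho> powr (1 / 4) \<le> ?x"
        using assms by (intro powr_mono2) auto
      then have "1 \<le> \<rho> powr - (1 / 4) * ?x"
        using assms by (simp add: powr_minus field_simps)
      then show ?thesis
        using N(2) by (simp add: c1_def algebra_simps)
    qed
    have "c1 * (\<epsilon> * \<tau>) powr (1 / 4) * ?N \<le> c1 * (\<epsilon> * \<tau>) powr (1 / 4) * (?x / c1)"
      using lower c by (intro mult_left_mono) auto
    also have "\<dots> = \<epsilon> powr (1 / 2)"
      using c by (simp add: prod [symmetric])
    also have "\<dots> \<le> 1"
      using et \<open>0 < \<epsilon>\<close> powr_mono2 [of "1 / 2" \<epsilon> 1] by simp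
    finally have 1: "c1 * (\<epsilon> * \<tau>) powr (1 / 4) \<le> 1 / ?N"
      using \<open>0 < ?N\<close> by (simp add: le_divide_eq)
    have "\<rho> powr (1 / 2) \<le> \<epsilon> powr (1 / 2)"
      using assms et by (intro powr_mono2) auto
    then have "b powr (1 / 4) * \<rho> powr (1 / 2) \<le> b powr (1 / 4) * ((\<epsilon> * \<tau>) powr (1 / 4) * ?x)"
      unfolding prod by (intro mult_left_mono) auto
    also have "\<dots> \<le> (\<epsilon> * \<tau>) powr (1 / 4) * ?N"
      using mult_left_mono [OF N(1), of "(\<epsilon> * \<tau>) powr (1 / 4)"] by (simp add: ac_simps)
    finally have "b powr (1 / 4) * \<rho> powr (1 / 2) \<le> (\<epsilon> * \<tau>) powr (1 / 4) * ?N" .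
    then have "1 / ?N \<le> c2 * (\<epsilon> * \<tau>) powr (1 / 4)"
      using \<open>0 < ?N\<close> assms x by (simp add: c2_def field_simps)
    then show ?thesis
      using 1 by blast
  qed
  ultimately show ?thesis
    by blast
qed


section \<open>Positive determinants for the cavity solution\<close>

lemma radial_nodal_polar_point: "radial_nodal (\<lambda>R. R) X polar_point"
  by (simp add: radial_nodal_def polar_point_def vec_eq_iff forall_2)

lemma radial_nodal_radial_map:
  assumes "X \<subseteq> {0<..}"
  shows "radial_nodal r X (\<lambda>b. radial_map r (polar_point b))"
proof -
  have "norm (polar_point (R, \<theta>)) = R" if "0 < R" for R \<theta>
    using that by (simp add: polar_point_def norm_vec_def L2_set_def sum_2 power_mult_distrib flip: distrib_left)
  then show ?thesis
    using assms by (auto simp: radial_nodal_def radial_map_def polar_point_def vec_eq_iff forall_2)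
qed

theorem theorem3p7:
  fixes \<omega> p lam_c lam \<rho> rc C0 m M Q :: real
    and g r :: "real \<Rightarrow> real"
  assumes "0 < \<omega>" and "1 < p" and "p < 2" and "volumetric_energy g"
    and "critical_stretch \<omega> p g lam_c" and "lam_c < lam"
    and "0 < \<rho>" and "\<rho> < 1"
    and "is_minimizer \<omega> p g \<rho> lam r"
    and "smooth_within {\<rho>..1} r"
    and "0 < rc" and "0 < C0" and "0 < m" and "m < M"
    and "\<And>R. R \<in> {\<rho>..1} \<Longrightarrow> rc \<le> r R"
    and "\<And>R. R \<in> {\<rho>..1} \<Longrightarrow>
           0 < nderiv_within {\<rho>..1} 2 r R \<and> nderiv_within {\<rho>..1} 2 r R \<le> C0"
    and "\<And>R. R \<in> {\<rho>..1} \<Longrightarrow>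
           m * R \<le> nderiv_within {\<rho>..1} 1 r R \<and> nderiv_within {\<rho>..1} 1 r R \<le> M * R"
    and "\<And>R. R \<in> {\<rho>..1} \<Longrightarrow> \<bar>nderiv_within {\<rho>..1} 3 r R\<bar> \<le> Q"
  shows "\<exists>\<tau>' > 0. \<exists>C > 0. \<exists>N' :: real \<Rightarrow> real \<Rightarrow> real \<Rightarrow> nat.
      (\<forall>Ls. layered_mesh \<rho> Ls \<longrightarrow>
         (\<forall>L\<in>set Ls. thickness L \<le> \<tau>' \<and> C * (thickness L)\<^sup>2 \<le> inner_radius L \<and>
            threshold_at r N' (inner_radius L) (thickness L) \<le> sectors L) \<longrightarrow>
         (\<forall>L\<in>set Ls. \<forall>a\<in>layer_elements L.
            (\<forall>y\<in>ref_triangle. pos_jacobian_det (elem_map a) (at y)) \<and>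
            (\<forall>x\<in>elem_set a.
               pos_jacobian_det (interpolant (radial_map r) a) (at x within elem_set a)))) \<and>
      (\<exists>c1 > 0. \<exists>c2 > 0. \<forall>\<epsilon> \<tau>.
         \<rho> \<le> \<epsilon> \<and> 0 < \<tau> \<and> \<epsilon> + \<tau> \<le> 1 \<and> \<tau> \<le> \<tau>' \<and> C * \<tau>\<^sup>2 \<le> \<epsilon> \<longrightarrow>
         c1 * (\<epsilon> * \<tau>) powr (1 / 4) \<le> 1 / real (threshold_at r N' \<epsilon> \<tau>) \<and>
         1 / real (threshold_at r N' \<epsilon> \<tau>) \<le> c2 * (\<epsilon> * \<tau>) powr (1 / 4))"
proof -
  note \<rho> = \<open>0 < \<rho>\<close> \<open>\<rho> < 1\<close>
  have dr: "(r has_real_derivative nderiv_within {\<rho>..1} 1 r x) (at x within {\<rho>..1})"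
    "(nderiv_within {\<rho>..1} 1 r has_real_derivative nderiv_within {\<rho>..1} 2 r x) (at x within {\<rho>..1})"
    if "x \<in> {\<rho>..1}" for x
    using smooth_within_nderiv [OF \<open>smooth_within {\<rho>..1} r\<close> that, of 0]
      smooth_within_nderiv [OF \<open>smooth_within {\<rho>..1} r\<close> that, of 1]
    by (simp_all add: nderiv_within_def numeral_2_eq_2)
  have r_pos: "0 < r x" "0 < nderiv_within {\<rho>..1} 1 r x" "\<bar>nderiv_within {\<rho>..1} 2 r x\<bar> \<le> C0"
    if x: "x \<in> {\<rho>..1}" for x
  proof -
    have "0 < m * x"
      using x \<rho> \<open>0 < m\<close> by simp
    then show "0 < nderiv_within {\<rho>..1} 1 r x"
      using assms(17) [OF x] by linarith
    show "0 < r x" "\<bar>nderiv_within {\<rho>..1} 2 r x\<bar> \<le> C0"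
      using assms(15,16) [OF x] \<open>0 < rc\<close> by auto
  qed
  define det_pos where "det_pos f L \<longleftrightarrow> (\<forall>v. radial_nodal f {\<rho>..1} v \<longrightarrow>
    (\<forall>a\<in>layer_elements L. \<forall>y\<in>ref_triangle. 0 < det (matrix (quad_deriv a v y))))" for f L
  obtain \<delta>1 where \<delta>1: "0 < \<delta>1" "\<And>L. \<rho> \<le> inner_radius L \<and> 0 < thickness L \<and> thickness L \<le> \<delta>1 \<and>
      inner_radius L + thickness L \<le> 1 \<and> 0 < sectors L \<and> 1 / real (sectors L) ^ 4 \<le> \<delta>1 * thickness L
      \<Longrightarrow> det_pos r L"
    using thin_layers_det_pos [OF dr r_pos \<rho>(2)] unfolding det_pos_def by metis
  have did: "((\<lambda>x. x) has_real_derivative 1) (at x within {\<rho>..1})"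
    "((\<lambda>x. 1) has_real_derivative 0) (at x within {\<rho>..1})" for x
    by (auto intro: derivative_eq_intros)
  obtain \<delta>2 where \<delta>2: "0 < \<delta>2" "\<And>L. \<rho> \<le> inner_radius L \<and> 0 < thickness L \<and> thickness L \<le> \<delta>2 \<and>
      inner_radius L + thickness L \<le> 1 \<and> 0 < sectors L \<and> 1 / real (sectors L) ^ 4 \<le> \<delta>2 * thickness L
      \<Longrightarrow> det_pos (\<lambda>x. x) L"
    using thin_layers_det_pos [OF did _ _ _ \<rho>(2), of 0] \<rho> unfolding det_pos_def by auto
  define \<delta> where "\<delta> = min \<delta>1 \<delta>2"
  have \<delta>: "0 < \<delta>" "\<delta> \<le> \<delta>1" "\<delta> \<le> \<delta>2"
    using \<delta>1(1) \<delta>2(1) by (auto simp: \<delta>_def)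
  \<comment> \<open>With \<open>\<epsilon> \<ge> \<rho>\<close>, the bound \<open>b * \<epsilon> / \<tau> \<le> N ^ 4\<close> yields \<open>1 / N ^ 4 \<le> \<delta> * \<tau>\<close> for this value of \<open>b\<close>.\<close>
  define b where "b = 1 / (\<rho> * \<delta>)"
  have b: "0 < b"
    using \<rho> \<delta> by (simp add: b_def)
  define N' :: "real \<Rightarrow> real \<Rightarrow> real \<Rightarrow> nat" where "N' \<kappa> \<kappa>\<^sub>0 \<kappa>\<^sub>h = layer_sectors b \<kappa>" for \<kappa> \<kappa>\<^sub>0 \<kappa>\<^sub>h
  have layer_ok: "det_pos r L \<and> det_pos (\<lambda>x. x) L"
    if L: "\<rho> \<le> inner_radius L" "0 < thickness L" "inner_radius L + thickness L \<le> 1" "0 < sectors L"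
      "thickness L \<le> \<delta>" "threshold_at r N' (inner_radius L) (thickness L) \<le> sectors L" for L
  proof -
    let ?\<tau> = "thickness L" and ?N = "real (sectors L)"
    have "b * (inner_radius L / ?\<tau>) \<le> ?N ^ 4"
      using L \<rho> b by (intro fourth_power_layer_sectors) (auto simp: threshold_at_def N'_def)
    moreover have "b * (\<rho> / ?\<tau>) \<le> b * (inner_radius L / ?\<tau>)"
      using L b by (intro mult_left_mono divide_right_mono) auto
    moreover have "b * (\<rho> / ?\<tau>) = 1 / (\<delta> * ?\<tau>)"
      using \<rho> by (simp add: b_def)
    ultimately have "1 / (\<delta> * ?\<tau>) \<le> ?N ^ 4"
      by linarith
    then have "1 / ?N ^ 4 \<le> \<delta> * ?\<tau>"
      using L \<delta> by (simp add: field_simps)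
    moreover have "\<delta> * ?\<tau> \<le> \<delta>1 * ?\<tau>" "\<delta> * ?\<tau> \<le> \<delta>2 * ?\<tau>"
      using L \<delta> by (auto intro: mult_right_mono)
    ultimately have "1 / ?N ^ 4 \<le> \<delta>1 * ?\<tau>" "1 / ?N ^ 4 \<le> \<delta>2 * ?\<tau>"
      by (meson order_trans)+
    then show ?thesis
      using L \<delta> by (intro conjI \<delta>1(2) \<delta>2(2)) auto
  qed
  have "pos_jacobian_det (elem_map a) (at y)"
    "x \<in> elem_set a \<Longrightarrow> pos_jacobian_det (interpolant (radial_map r) a) (at x within elem_set a)"
    if L: "det_pos r L \<and> det_pos (\<lambda>x. x) L" and a: "a \<in> layer_elements L" and y: "y \<in> ref_triangle" for L a x y
  proof -
    have F: "0 < det (matrix (quad_deriv a polar_point z))" if "z \<in> ref_triangle" for z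
      using L a that radial_nodal_polar_point unfolding det_pos_def by blast
    have "radial_nodal r {\<rho>..1} (\<lambda>b. radial_map r (polar_point b))"
      using \<rho> by (intro radial_nodal_radial_map) auto
    then have P: "0 < det (matrix (quad_deriv a (\<lambda>b. radial_map r (polar_point b)) z))"
      if "z \<in> ref_triangle" for z
      using L a that unfolding det_pos_def by blast
    show "pos_jacobian_det (elem_map a) (at y)"
      unfolding pos_jacobian_det_def elem_map_def
      using F [OF y] quad_combination_has_derivative by blast
    show "pos_jacobian_det (interpolant (radial_map r) a) (at x within elem_set a)" if "x \<in> elem_set a"
      using pos_jacobian_det_interpolant [OF F P that] .
  qed
  note elem_ok = this
  \<comment> \<open>The factor \<open>1\<close> in front of the squared thickness is the witness for \<open>C\<close>.\<close>
  have "\<forall>Ls. layered_mesh \<rho> Ls \<longrightarrow>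
         (\<forall>L\<in>set Ls. thickness L \<le> \<delta> \<and> 1 * (thickness L)\<^sup>2 \<le> inner_radius L \<and>
            threshold_at r N' (inner_radius L) (thickness L) \<le> sectors L) \<longrightarrow>
         (\<forall>L\<in>set Ls. \<forall>a\<in>layer_elements L.
            (\<forall>y\<in>ref_triangle. pos_jacobian_det (elem_map a) (at y)) \<and>
            (\<forall>x\<in>elem_set a.
               pos_jacobian_det (interpolant (radial_map r) a) (at x within elem_set a)))"
  proof (intro allI impI ballI)
    fix Ls L a
    assume "layered_mesh \<rho> Ls" and h: "\<forall>L\<in>set Ls. thickness L \<le> \<delta> \<and> 1 * (thickness L)\<^sup>2 \<le> inner_radius L \<and>
            threshold_at r N' (inner_radius L) (thickness L) \<le> sectors L"
      and L: "L \<in> set Ls" and a: "a \<in> layer_elements L"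
    then have "det_pos r L \<and> det_pos (\<lambda>x. x) L"
      by (intro layer_ok) (auto simp: layered_mesh_def)
    moreover have "0 \<in> ref_triangle"
      by (simp add: ref_triangle_def)
    ultimately show "(\<forall>y\<in>ref_triangle. pos_jacobian_det (elem_map a) (at y)) \<and>
            (\<forall>x\<in>elem_set a. pos_jacobian_det (interpolant (radial_map r) a) (at x within elem_set a))"
      using elem_ok a by blast
  qed
  moreover have "\<exists>c1 > 0. \<exists>c2 > 0. \<forall>\<epsilon> \<tau>.
         \<rho> \<le> \<epsilon> \<and> 0 < \<tau> \<and> \<epsilon> + \<tau> \<le> 1 \<and> \<tau> \<le> \<delta> \<and> 1 * \<tau>\<^sup>2 \<le> \<epsilon> \<longrightarrow>
         c1 * (\<epsilon> * \<tau>) powr (1 / 4) \<le> 1 / real (threshold_at r N' \<epsilon> \<tau>) \<and>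
         1 / real (threshold_at r N' \<epsilon> \<tau>) \<le> c2 * (\<epsilon> * \<tau>) powr (1 / 4)"
  proof -
    obtain c1 c2 where "0 < c1" "0 < c2" and c: "\<forall>\<epsilon> \<tau>. \<rho> \<le> \<epsilon> \<and> 0 < \<tau> \<and> \<epsilon> \<le> 1 \<and> \<tau> \<le> 1 \<longrightarrow>
      c1 * (\<epsilon> * \<tau>) powr (1 / 4) \<le> 1 / real (layer_sectors b (\<epsilon> / \<tau>)) \<and>
      1 / real (layer_sectors b (\<epsilon> / \<tau>)) \<le> c2 * (\<epsilon> * \<tau>) powr (1 / 4)"
      using layer_sectors_asymp [OF b \<rho>(1)] by blast
    then show ?thesis
      unfolding threshold_at_def N'_def using \<rho>
      by (intro exI [of _ c1] exI [of _ c2] conjI allI impI; simp)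
  qed
  ultimately show ?thesis
    using \<delta>(1) zero_less_one by blast
qed

end
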